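(* Let $G$ be a group definable in a monster model $\mathfrak{C}$ of a complete $\mathrm{NTP}_2$ theory, let $\varphi(x,y)$ be a formula and $C$ a set of parameters such that $\{\varphi(\mathfrak{C},a) : a\in C\}$ is a family of normal subgroups of $G$. Then there is some $k\in\omega$ (depending only on $\varphi$) such that for every finite $C'\subseteq C$ there is some $C_0\subseteq C'$ with $|C_0|\le k$ and $$\Big[\bigcap_{a\in C_0}\varphi(\mathfrak{C},a)\;:\;\bigcap_{a\in C'}\varphi(\mathfrak{C},a)\Big]<\infty.$$
   Context: A formula $\varphi(x,y)$ has $\mathrm{TP}_2$ if there are tuples $(a_{i,j})_{i,j\in\omega}$ and $k\in\omega$ such that for each $i$ the set $\{\varphi(x,a_{i,j}) : j<\omega\}$ is $k$-inconsistent, and for every $f:\omega\to\omega$ the set $\{\varphi(x,a_{i,f(i)}) : i<\omega\}$ is consistent. A theory is $\mathrm{NTP}_2$ if no formula has $\mathrm{TP}_2$. Definable means definable with parameters. *)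

theory Defs
  imports "HOL-Algebra.Coset"
begin

unbundle cardinal_syntax

section \<open>First-order logic\<close>

text \<open>A symbol is a name together with its arity; constants are function symbols of arity 0.\<close>

record ('f, 'r) language =
  Funs :: "('f \<times> nat) set"
  Rels :: "('r \<times> nat) set"

datatype 'f tm = Var nat | Fn 'f "'f tm list"

datatype ('f, 'r) fm =
    Eq "'f tm" "'f tm"
  | Rel 'r "'f tm list"
  | Neg "('f, 'r) fm"
  | And "('f, 'r) fm" "('f, 'r) fm"
  | Ex nat "('f, 'r) fm"

fun wf_tm :: "('f, 'r) language \<Rightarrow> 'f tm \<Rightarrow> bool" where
  "wf_tm L (Var i) = True"
| "wf_tm L (Fn f ts) = ((f, length ts) \<in> Funs L \<and> (\<forall>t\<in>set ts. wf_tm L t))"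

fun wf_fm :: "('f, 'r) language \<Rightarrow> ('f, 'r) fm \<Rightarrow> bool" where
  "wf_fm L (Eq s t) = (wf_tm L s \<and> wf_tm L t)"
| "wf_fm L (Rel r ts) = ((r, length ts) \<in> Rels L \<and> (\<forall>t\<in>set ts. wf_tm L t))"
| "wf_fm L (Neg \<phi>) = wf_fm L \<phi>"
| "wf_fm L (And \<phi> \<psi>) = (wf_fm L \<phi> \<and> wf_fm L \<psi>)"
| "wf_fm L (Ex i \<phi>) = wf_fm L \<phi>"

fun fv_tm :: "'f tm \<Rightarrow> nat set" where
  "fv_tm (Var i) = {i}"
| "fv_tm (Fn f ts) = (\<Union>t\<in>set ts. fv_tm t)"

fun fv :: "('f, 'r) fm \<Rightarrow> nat set" where
  "fv (Eq s t) = fv_tm s \<union> fv_tm t"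
| "fv (Rel r ts) = (\<Union>t\<in>set ts. fv_tm t)"
| "fv (Neg \<phi>) = fv \<phi>"
| "fv (And \<phi> \<psi>) = fv \<phi> \<union> fv \<psi>"
| "fv (Ex i \<phi>) = fv \<phi> - {i}"

text \<open>The formulas of \<open>L\<close> in the variables \<open>0, \<dots>, n - 1\<close>; the sentences are \<open>formulas L 0\<close>.\<close>

definition formulas :: "('f, 'r) language \<Rightarrow> nat \<Rightarrow> ('f, 'r) fm set" where
  "formulas L n = {\<phi>. wf_fm L \<phi> \<and> fv \<phi> \<subseteq> {..<n}}"

record ('f, 'r, 'a) fo_structure =
  univ :: "'a set"
  fun_int :: "'f \<Rightarrow> 'a list \<Rightarrow> 'a"
  rel_int :: "'r \<Rightarrow> 'a list \<Rightarrow> bool"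

definition tuples :: "('f, 'r, 'a) fo_structure \<Rightarrow> nat \<Rightarrow> 'a list set" where
  "tuples M n = {b. length b = n \<and> set b \<subseteq> univ M}"

definition is_structure :: "('f, 'r) language \<Rightarrow> ('f, 'r, 'a) fo_structure \<Rightarrow> bool" where
  "is_structure L M \<longleftrightarrow> univ M \<noteq> {} \<and>
     (\<forall>(f, n)\<in>Funs L. \<forall>b\<in>tuples M n. fun_int M f b \<in> univ M)"

fun eval_tm :: "('f, 'r, 'a) fo_structure \<Rightarrow> (nat \<Rightarrow> 'a) \<Rightarrow> 'f tm \<Rightarrow> 'a" where
  "eval_tm M v (Var i) = v i"
| "eval_tm M v (Fn f ts) = fun_int M f (map (eval_tm M v) ts)"

fun sat :: "('f, 'r, 'a) fo_structure \<Rightarrow> (nat \<Rightarrow> 'a) \<Rightarrow> ('f, 'r) fm \<Rightarrow> bool" where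
  "sat M v (Eq s t) = (eval_tm M v s = eval_tm M v t)"
| "sat M v (Rel r ts) = rel_int M r (map (eval_tm M v) ts)"
| "sat M v (Neg \<phi>) = (\<not> sat M v \<phi>)"
| "sat M v (And \<phi> \<psi>) = (sat M v \<phi> \<and> sat M v \<psi>)"
| "sat M v (Ex i \<phi>) = (\<exists>d\<in>univ M. sat M (v(i := d)) \<phi>)"

text \<open>\<open>holds M \<phi> b\<close> is \<open>M \<Turnstile> \<phi>(b)\<close>, the variable \<open>i\<close> standing for the \<open>i\<close>-th entry of \<open>b\<close>.
  It is only used for \<open>\<phi> \<in> formulas L (length b)\<close>, so entries beyond the end of \<open>b\<close> do
  not matter.\<close>

definition holds :: "('f, 'r, 'a) fo_structure \<Rightarrow> ('f, 'r) fm \<Rightarrow> 'a list \<Rightarrow> bool" where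
  "holds M \<phi> b \<longleftrightarrow> sat M (\<lambda>i. b ! i) \<phi>"

text \<open>As usual for complete theories, theories are taken to be deductively closed, so a complete
  theory contains each sentence or its negation. Consistency is not part of the definition.\<close>

definition complete_theory :: "('f, 'r) language \<Rightarrow> ('f, 'r) fm set \<Rightarrow> bool" where
  "complete_theory L T \<longleftrightarrow> T \<subseteq> formulas L 0 \<and> (\<forall>\<phi>\<in>formulas L 0. \<phi> \<in> T \<or> Neg \<phi> \<in> T)"

definition is_model :: "('f, 'r) language \<Rightarrow> ('f, 'r) fm set \<Rightarrow> ('f, 'r, 'a) fo_structure \<Rightarrow> bool" where
  "is_model L T M \<longleftrightarrow> is_structure L M \<and> (\<forall>\<phi>\<in>T. holds M \<phi> [])"


section \<open>Formulas with parameters, types, definable sets\<close>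

text \<open>A formula \<open>\<phi>(x, c)\<close> in the \<open>n\<close>-tuple \<open>x\<close> with parameters from \<open>A\<close> is a pair \<open>(\<phi>, c)\<close>: the
  variables \<open>0, \<dots>, n - 1\<close> of \<open>\<phi>\<close> form \<open>x\<close>, and the following ones stand for \<open>c\<close>.\<close>

definition formulas_over ::
    "('f, 'r) language \<Rightarrow> 'a set \<Rightarrow> nat \<Rightarrow> (('f, 'r) fm \<times> 'a list) set" where
  "formulas_over L A n = {(\<phi>, c). \<phi> \<in> formulas L (n + length c) \<and> set c \<subseteq> A}"

definition solutions ::
    "('f, 'r, 'a) fo_structure \<Rightarrow> nat \<Rightarrow> ('f, 'r) fm \<Rightarrow> 'a list \<Rightarrow> 'a list set" where
  "solutions M n \<phi> c = {b \<in> tuples M n. holds M \<phi> (b @ c)}"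

definition realised ::
    "('f, 'r, 'a) fo_structure \<Rightarrow> nat \<Rightarrow> (('f, 'r) fm \<times> 'a list) set \<Rightarrow> bool" where
  "realised M n p \<longleftrightarrow> (\<exists>b\<in>tuples M n. \<forall>(\<phi>, c)\<in>p. b \<in> solutions M n \<phi> c)"

text \<open>Consistency is relative to the theory of \<open>M\<close> with names for all elements. As that theory is
  complete, it means that every finite subset is satisfiable in \<open>M\<close>.\<close>

definition consistent ::
    "('f, 'r, 'a) fo_structure \<Rightarrow> nat \<Rightarrow> (('f, 'r) fm \<times> 'a list) set \<Rightarrow> bool" where
  "consistent M n p \<longleftrightarrow> (\<forall>q. finite q \<and> q \<subseteq> p \<longrightarrow> realised M n q)"

definition definable ::
    "('f, 'r) language \<Rightarrow> ('f, 'r, 'a) fo_structure \<Rightarrow> nat \<Rightarrow> 'a list set \<Rightarrow> bool" where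
  "definable L M n X \<longleftrightarrow> (\<exists>(\<phi>, c)\<in>formulas_over L (univ M) n. X = solutions M n \<phi> c)"

definition definable_group ::
    "('f, 'r) language \<Rightarrow> ('f, 'r, 'a) fo_structure \<Rightarrow> nat \<Rightarrow> 'a list monoid \<Rightarrow> bool" where
  "definable_group L M n G \<longleftrightarrow> group G \<and> definable L M n (carrier G) \<and>
     definable L M (n + n + n)
       {x @ y @ (x \<otimes>\<^bsub>G\<^esub> y) |x y. x \<in> carrier G \<and> y \<in> carrier G}"


section \<open>Monster models\<close>

definition saturated ::
    "('f, 'r) language \<Rightarrow> 'k rel \<Rightarrow> ('f, 'r, 'a) fo_structure \<Rightarrow> bool" where
  "saturated L \<kappa> M \<longleftrightarrow>
     (\<forall>A n p. A \<subseteq> univ M \<and> |A| <o \<kappa> \<and> p \<subseteq> formulas_over L A n \<and> consistent M n p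
        \<longrightarrow> realised M n p)"

definition elementary_map ::
    "('f, 'r) language \<Rightarrow> ('f, 'r, 'a) fo_structure \<Rightarrow> 'a set \<Rightarrow> ('a \<Rightarrow> 'a) \<Rightarrow> bool" where
  "elementary_map L M A h \<longleftrightarrow> A \<subseteq> univ M \<and> h ` A \<subseteq> univ M \<and>
     (\<forall>c \<phi>. set c \<subseteq> A \<and> \<phi> \<in> formulas L (length c) \<longrightarrow> (holds M \<phi> c \<longleftrightarrow> holds M \<phi> (map h c)))"

definition automorphism ::
    "('f, 'r) language \<Rightarrow> ('f, 'r, 'a) fo_structure \<Rightarrow> ('a \<Rightarrow> 'a) \<Rightarrow> bool" where
  "automorphism L M \<sigma> \<longleftrightarrow> bij_betw \<sigma> (univ M) (univ M) \<and>
     (\<forall>(f, n)\<in>Funs L. \<forall>b\<in>tuples M n. \<sigma> (fun_int M f b) = fun_int M f (map \<sigma> b)) \<and>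
     (\<forall>(r, n)\<in>Rels L. \<forall>b\<in>tuples M n. rel_int M r b \<longleftrightarrow> rel_int M r (map \<sigma> b))"

definition strongly_homogeneous ::
    "('f, 'r) language \<Rightarrow> 'k rel \<Rightarrow> ('f, 'r, 'a) fo_structure \<Rightarrow> bool" where
  "strongly_homogeneous L \<kappa> M \<longleftrightarrow>
     (\<forall>A h. |A| <o \<kappa> \<and> elementary_map L M A h
        \<longrightarrow> (\<exists>\<sigma>. automorphism L M \<sigma> \<and> (\<forall>a\<in>A. \<sigma> a = h a)))"

text \<open>The cardinal \<open>\<kappa>\<close> bounds the small parameter sets. It may be any uncountable cardinal
  exceeding the size of the language.\<close>

definition monster_model ::
    "('f, 'r) language \<Rightarrow> ('f, 'r) fm set \<Rightarrow> 'k rel \<Rightarrow> ('f, 'r, 'a) fo_structure \<Rightarrow> bool" where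
  "monster_model L T \<kappa> M \<longleftrightarrow>
     Card_order \<kappa> \<and> natLeq <o \<kappa> \<and> |Funs L| <o \<kappa> \<and> |Rels L| <o \<kappa> \<and>
     is_model L T M \<and> saturated L \<kappa> M \<and> strongly_homogeneous L \<kappa> M"


section \<open>The tree property of the second kind\<close>

text \<open>\<open>k\<close>-inconsistency concerns the family indexed by \<open>j\<close>, not just its range: a constant family
  has a one-element range and would otherwise be vacuously 2-inconsistent.\<close>

definition k_inconsistent ::
    "('f, 'r, 'a) fo_structure \<Rightarrow> nat \<Rightarrow> nat \<Rightarrow> (nat \<Rightarrow> ('f, 'r) fm \<times> 'a list) \<Rightarrow> bool" where
  "k_inconsistent M n k p \<longleftrightarrow> (\<forall>J. finite J \<and> card J = k \<longrightarrow> \<not> consistent M n (p ` J))"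

text \<open>\<open>\<phi>(x, y)\<close>, with \<open>x\<close> an \<open>n\<close>-tuple and \<open>y\<close> an \<open>m\<close>-tuple of variables, has \<open>TP\<^sub>2\<close>. As usual, the
  tuples \<open>a i j\<close> are taken in the monster model \<open>M\<close> of the theory in question.\<close>

definition TP2 ::
    "('f, 'r, 'a) fo_structure \<Rightarrow> nat \<Rightarrow> nat \<Rightarrow> ('f, 'r) fm \<Rightarrow> bool" where
  "TP2 M n m \<phi> \<longleftrightarrow>
     (\<exists>(a :: nat \<Rightarrow> nat \<Rightarrow> 'a list) k.
        (\<forall>i j. a i j \<in> tuples M m) \<and>
        (\<forall>i. k_inconsistent M n k (\<lambda>j. (\<phi>, a i j))) \<and>
        (\<forall>f :: nat \<Rightarrow> nat. consistent M n (range (\<lambda>i. (\<phi>, a i (f i))))))"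

definition NTP2 :: "('f, 'r) language \<Rightarrow> ('f, 'r, 'a) fo_structure \<Rightarrow> bool" where
  "NTP2 L M \<longleftrightarrow> (\<forall>n m. \<forall>\<phi>\<in>formulas L (n + m). \<not> TP2 M n m \<phi>)"


section \<open>Intersections and index\<close>

text \<open>The intersection is taken inside \<open>G\<close>, so that the empty one is \<open>G\<close>.\<close>

definition Inter_in ::
    "('f, 'r, 'a) fo_structure \<Rightarrow> nat \<Rightarrow> 'a list monoid \<Rightarrow> ('f, 'r) fm \<Rightarrow> 'a list set \<Rightarrow> 'a list set" where
  "Inter_in M n G \<phi> C = carrier G \<inter> (\<Inter>a\<in>C. solutions M n \<phi> a)"

definition finite_index :: "('g, 'b) monoid_scheme \<Rightarrow> 'g set \<Rightarrow> 'g set \<Rightarrow> bool" where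
  "finite_index G H K \<longleftrightarrow> finite (rcosets\<^bsub>G\<lparr>carrier := H\<rparr>\<^esub> K)"

end

theory Submission
  imports Defs "HOL-Library.Nat_Bijection"
begin

text \<open>Choose \<open>C\<^sub>0 \<subseteq> C'\<close> of least size such that the index is finite. By minimality, for every
  \<open>a \<in> C\<^sub>0\<close> the intersection of the other subgroups from \<open>C\<^sub>0\<close> meets infinitely many cosets of
  \<open>H a = \<phi>(M, a)\<close>, say those of \<open>b a j\<close> for \<open>j < \<omega>\<close>. The cosets of \<open>H a\<close> are disjoint, while by
  normality the product of the \<open>b a (f a)\<close> over \<open>a \<in> C\<^sub>0\<close> lies in every \<open>H a #> b a (f a)\<close>. So the
  formula \<open>x \<in> H y #> z\<close> has an array with \<open>card C\<^sub>0\<close> rows as in the definition of \<open>TP\<^sub>2\<close>, and if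
  \<open>card C\<^sub>0\<close> were unbounded, compactness would give \<open>TP\<^sub>2\<close>. The parameters defining \<open>G\<close> are made part
  of the array entries; in the infinite array they may vary.\<close>


section \<open>Renaming variables\<close>

lemma finite_fv_tm: "finite (fv_tm t)"
  by (induction t) auto

lemma finite_fv: "finite (fv \<phi>)"
  by (induction \<phi>) (auto simp: finite_fv_tm)

lemma eval_tm_cong: "(\<And>i. i \<in> fv_tm t \<Longrightarrow> v i = w i) \<Longrightarrow> eval_tm M v t = eval_tm M w t"
proof (induction t)
  case (Fn f ts)
  then have "map (eval_tm M v) ts = map (eval_tm M w) ts" by auto
  then show ?case by (simp del: map_eq_conv)
qed auto

lemma sat_cong: "(\<And>i. i \<in> fv \<phi> \<Longrightarrow> v i = w i) \<Longrightarrow> sat M v \<phi> \<longleftrightarrow> sat M w \<phi>"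
proof (induction \<phi> arbitrary: v w)
  case (Eq s t)
  then show ?case using eval_tm_cong[of s v w M] eval_tm_cong[of t v w M] by auto
next
  case (Rel r ts)
  then have "map (eval_tm M v) ts = map (eval_tm M w) ts" by (auto intro!: eval_tm_cong)
  then show ?case by (simp del: map_eq_conv)
next
  case (Neg \<phi>)
  have "sat M v \<phi> \<longleftrightarrow> sat M w \<phi>" by (rule Neg.IH) (use Neg.prems in auto)
  then show ?case by simp
next
  case (And \<phi> \<psi>)
  have "sat M v \<phi> \<longleftrightarrow> sat M w \<phi>" by (rule And.IH) (use And.prems in auto)
  moreover have "sat M v \<psi> \<longleftrightarrow> sat M w \<psi>" by (rule And.IH) (use And.prems in auto)
  ultimately show ?case by simp
next
  case (Ex i \<phi>)
  have "sat M (v(i := d)) \<phi> \<longleftrightarrow> sat M (w(i := d)) \<phi>" for d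
    by (rule Ex.IH) (use Ex.prems in auto)
  then show ?case by simp
qed

fun rename_tm :: "(nat \<Rightarrow> nat) \<Rightarrow> 'f tm \<Rightarrow> 'f tm" where
  "rename_tm \<sigma> (Var i) = Var (\<sigma> i)"
| "rename_tm \<sigma> (Fn f ts) = Fn f (map (rename_tm \<sigma>) ts)"

text \<open>Each bound variable is replaced by one above the images of all variables free in the
  body, so nothing is captured and \<open>\<sigma>\<close> may be any map. The
  \<open>insert 0\<close> keeps \<open>Max\<close> meaningful when the body has no free
  variable.\<close>

fun rename :: "(nat \<Rightarrow> nat) \<Rightarrow> ('f, 'r) fm \<Rightarrow> ('f, 'r) fm" where
  "rename \<sigma> (Eq s t) = Eq (rename_tm \<sigma> s) (rename_tm \<sigma> t)"
| "rename \<sigma> (Rel r ts) = Rel r (map (rename_tm \<sigma>) ts)"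
| "rename \<sigma> (Neg \<phi>) = Neg (rename \<sigma> \<phi>)"
| "rename \<sigma> (And \<phi> \<psi>) = And (rename \<sigma> \<phi>) (rename \<sigma> \<psi>)"
| "rename \<sigma> (Ex i \<phi>) =
     (let j = Suc (Max (insert 0 (\<sigma> ` fv \<phi>))) in Ex j (rename (\<sigma>(i := j)) \<phi>))"

lemma less_fresh: "i \<in> fv \<phi> \<Longrightarrow> \<sigma> i < Suc (Max (insert 0 (\<sigma> ` fv \<phi>)))"
  by (simp add: finite_fv le_imp_less_Suc)

lemma wf_rename_tm: "wf_tm L (rename_tm \<sigma> t) \<longleftrightarrow> wf_tm L t"
  by (induction t) auto

lemma wf_rename: "wf_fm L (rename \<sigma> \<phi>) \<longleftrightarrow> wf_fm L \<phi>"
  by (induction \<phi> arbitrary: \<sigma>) (auto simp: wf_rename_tm Let_def)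

lemma fv_rename_tm: "fv_tm (rename_tm \<sigma> t) = \<sigma> ` fv_tm t"
  by (induction t) auto

lemma fv_rename: "fv (rename \<sigma> \<phi>) = \<sigma> ` fv \<phi>"
proof (induction \<phi> arbitrary: \<sigma>)
  case (Ex i \<phi>)
  define j where "j = Suc (Max (insert 0 (\<sigma> ` fv \<phi>)))"
  have "x \<in> fv \<phi> \<Longrightarrow> \<sigma> x \<noteq> j" for x using less_fresh[of x \<phi> \<sigma>] by (auto simp: j_def)
  then have "(\<sigma>(i := j)) ` fv \<phi> - {j} = \<sigma> ` (fv \<phi> - {i})" by (auto simp: image_iff)
  then show ?case by (simp add: Ex.IH j_def[symmetric] del: fun_upd_apply)
qed (auto simp: fv_rename_tm)

lemma eval_rename_tm: "eval_tm M v (rename_tm \<sigma> t) = eval_tm M (\<lambda>i. v (\<sigma> i)) t"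
proof (induction t)
  case (Fn f ts)
  then have "map (eval_tm M v \<circ> rename_tm \<sigma>) ts = map (eval_tm M (\<lambda>i. v (\<sigma> i))) ts" by auto
  then show ?case by (simp del: map_eq_conv)
qed auto

lemma sat_rename: "sat M v (rename \<sigma> \<phi>) \<longleftrightarrow> sat M (\<lambda>i. v (\<sigma> i)) \<phi>"
proof (induction \<phi> arbitrary: v \<sigma>)
  case (Rel r ts)
  have "map (eval_tm M v \<circ> rename_tm \<sigma>) ts = map (eval_tm M (\<lambda>i. v (\<sigma> i))) ts"
    by (auto simp: eval_rename_tm)
  then show ?case by (simp del: map_eq_conv)
next
  case (Ex i \<phi>)
  define j where "j = Suc (Max (insert 0 (\<sigma> ` fv \<phi>)))"
  have "x \<in> fv \<phi> \<Longrightarrow> \<sigma> x \<noteq> j" for x using less_fresh[of x \<phi> \<sigma>] by (auto simp: j_def)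
  \<comment> \<open>The two assignments may differ off \<open>fv \<phi>\<close>, where
    \<open>\<sigma>\<close> can take the value \<open>j\<close>; on \<open>fv \<phi>\<close> the
    freshness of \<open>j\<close> makes them equal.\<close>
  then have "sat M (\<lambda>k. (v(j := d)) ((\<sigma>(i := j)) k)) \<phi> \<longleftrightarrow> sat M ((\<lambda>k. v (\<sigma> k))(i := d)) \<phi>" for d
    by (intro sat_cong) auto
  then show ?case by (simp add: Ex.IH j_def[symmetric] del: fun_upd_apply)
qed (auto simp: eval_rename_tm)


section \<open>Iterated quantifiers and conjunctions\<close>

definition exs :: "nat list \<Rightarrow> ('f, 'r) fm \<Rightarrow> ('f, 'r) fm" where
  "exs is \<phi> = foldr Ex is \<phi>"

lemma wf_exs: "wf_fm L (exs is \<phi>) \<longleftrightarrow> wf_fm L \<phi>"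
  by (induction "is") (auto simp: exs_def)

lemma fv_exs: "fv (exs is \<phi>) = fv \<phi> - set is"
  by (induction "is") (auto simp: exs_def)

lemma sat_exs:
  "sat M v (exs is \<phi>) \<longleftrightarrow>
     (\<exists>w. w ` set is \<subseteq> univ M \<and> (\<forall>i. i \<notin> set is \<longrightarrow> w i = v i) \<and> sat M w \<phi>)"
proof (induction "is" arbitrary: v)
  case Nil
  have "(\<forall>i. w i = v i) \<longleftrightarrow> w = v" for w by auto
  then show ?case by (simp add: exs_def)
next
  case (Cons i "is")
  have "sat M v (exs (i # is) \<phi>) \<longleftrightarrow> (\<exists>d\<in>univ M. sat M (v(i := d)) (exs is \<phi>))"
    by (simp add: exs_def)
  also have "\<dots> \<longleftrightarrow> (\<exists>w. w ` set (i # is) \<subseteq> univ M \<and>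
      (\<forall>j. j \<notin> set (i # is) \<longrightarrow> w j = v j) \<and> sat M w \<phi>)" (is "?l \<longleftrightarrow> ?r")
  proof
    assume ?l
    then obtain d w where "d \<in> univ M" "w ` set is \<subseteq> univ M"
      "\<forall>j. j \<notin> set is \<longrightarrow> w j = (v(i := d)) j" "sat M w \<phi>"
      using Cons.IH by blast
    then show ?r by (intro exI[of _ w]) (auto split: if_splits)
  next
    assume ?r
    then obtain w where w: "w ` set (i # is) \<subseteq> univ M"
      "\<forall>j. j \<notin> set (i # is) \<longrightarrow> w j = v j" "sat M w \<phi>" by blast
    then have "w i \<in> univ M" "sat M (v(i := w i)) (exs is \<phi>)"
      unfolding Cons.IH by (auto intro!: exI[of _ w])
    then show ?l by blast
  qed
  finally show ?case .
qed

text \<open>The empty conjunction has to be well-formed in every language and without free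
  variables; the sentence chosen is true as soon as the universe is nonempty.\<close>

definition conjs :: "('f, 'r) fm list \<Rightarrow> ('f, 'r) fm" where
  "conjs \<phi>s = foldr And \<phi>s (Ex 0 (Eq (Var 0) (Var 0)))"

lemma wf_conj: "wf_fm L (conjs \<phi>s) \<longleftrightarrow> (\<forall>\<phi>\<in>set \<phi>s. wf_fm L \<phi>)"
  by (induction \<phi>s) (auto simp: conjs_def)

lemma fv_conj: "fv (conjs \<phi>s) = (\<Union>\<phi>\<in>set \<phi>s. fv \<phi>)"
  by (induction \<phi>s) (auto simp: conjs_def)

lemma sat_conj: "univ M \<noteq> {} \<Longrightarrow> sat M v (conjs \<phi>s) \<longleftrightarrow> (\<forall>\<phi>\<in>set \<phi>s. sat M v \<phi>)"
  by (induction \<phi>s) (auto simp: conjs_def)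


section \<open>Compactness in countably many variables\<close>

text \<open>Saturation only speaks of types in finitely many variables, so the variables are assigned one
  at a time by realising 1-types. The formula \<open>E \<phi>s\<close> says that the values chosen so far extend to an
  assignment satisfying \<open>\<phi>s\<close>; its variable 0 is the one to be assigned next.\<close>

lemma saturated_assignment:
  fixes M :: "('f, 'r, 'a) fo_structure" and \<Theta> :: "('f, 'r) fm set"
  assumes sat: "saturated L \<kappa> M" and inf: "natLeq <o \<kappa>" and ne: "univ M \<noteq> {}"
    and wf: "\<And>\<theta>. \<theta> \<in> \<Theta> \<Longrightarrow> wf_fm L \<theta>"
    and fin: "\<And>\<Phi>. finite \<Phi> \<Longrightarrow> \<Phi> \<subseteq> \<Theta> \<Longrightarrow> \<exists>w. range w \<subseteq> univ M \<and> (\<forall>\<theta>\<in>\<Phi>. sat M w \<theta>)"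
  shows "\<exists>w. range w \<subseteq> univ M \<and> (\<forall>\<theta>\<in>\<Theta>. sat M w \<theta>)"
proof -
  \<comment> \<open>The invariant of the recursion: the values of \<open>v\<close> below
    \<open>i\<close> keep \<open>\<Theta>\<close> finitely satisfiable, while those from
    \<open>i\<close> on are unconstrained.\<close>
  define I where "I i v \<longleftrightarrow> v ` {..<i} \<subseteq> univ M \<and> (\<forall>\<Phi>. finite \<Phi> \<and> \<Phi> \<subseteq> \<Theta> \<longrightarrow>
      (\<exists>w. range w \<subseteq> univ M \<and> (\<forall>j<i. w j = v j) \<and> (\<forall>\<theta>\<in>\<Phi>. sat M w \<theta>)))"
    for i :: nat and v :: "nat \<Rightarrow> 'a"
  have step: "\<exists>d. I (Suc i) (v(i := d))" if Iv: "I i v" for i v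
  proof -
    define l where "l = map v [0..<i]"
    \<comment> \<open>The layout of a 1-type over \<open>l\<close>: variable \<open>i\<close>
      becomes the type variable 0, and an earlier variable \<open>j\<close> reads entry
      \<open>j\<close> of \<open>l\<close>. Later variables are quantified in
      \<open>E\<close>.\<close>
    define \<sigma> where "\<sigma> j = (if j = i then 0 else Suc j)" for j
    define E where "E \<phi>s = (let \<phi> = conjs \<phi>s in
      rename \<sigma> (exs (filter (\<lambda>j. i < j) (sorted_list_of_set (fv \<phi>))) \<phi>))" for \<phi>s :: "('f, 'r) fm list"
    define p where "p = {(E \<phi>s, l) | \<phi>s. set \<phi>s \<subseteq> \<Theta>}"
    have l: "length l = i" "set l \<subseteq> univ M" using Iv by (auto simp: l_def I_def)
    have nth: "((d # l) ! \<sigma> j) = (v(i := d)) j" if "j \<le> i" for d j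
      using that by (auto simp: \<sigma>_def l_def)
    have E: "holds M (E \<phi>s) (d # l) \<longleftrightarrow>
        (\<exists>w. range w \<subseteq> univ M \<and> (\<forall>j<Suc i. w j = (v(i := d)) j) \<and> (\<forall>\<theta>\<in>set \<phi>s. sat M w \<theta>))"
      (is "?l \<longleftrightarrow> ?r") if d: "d \<in> univ M" for d \<phi>s
    proof -
      have vd: "j \<le> i \<Longrightarrow> (v(i := d)) j \<in> univ M" for j
        using Iv d by (auto simp: I_def)
      let ?js = "filter (\<lambda>j. i < j) (sorted_list_of_set (fv (conjs \<phi>s)))"
      have js: "set ?js = {j \<in> fv (conjs \<phi>s). i < j}" by (auto simp: finite_fv)
      have *: "?l \<longleftrightarrow> (\<exists>w. w ` set ?js \<subseteq> univ M \<and>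
          (\<forall>j. j \<notin> set ?js \<longrightarrow> w j = (d # l) ! \<sigma> j) \<and> sat M w (conjs \<phi>s))"
        by (simp add: holds_def E_def Let_def sat_rename sat_exs o_def)
      obtain e where e: "e \<in> univ M" using ne by blast
      show ?thesis
      proof
        assume ?l
        then obtain w where w: "w ` set ?js \<subseteq> univ M"
          "\<And>j. j \<notin> set ?js \<Longrightarrow> w j = (d # l) ! \<sigma> j" "sat M w (conjs \<phi>s)"
          unfolding * by blast
        \<comment> \<open>At a variable above \<open>i\<close> that is not free in
          \<open>conjs \<phi>s\<close>, \<open>w\<close> reads \<open>d # l\<close> beyond its end;
          the default \<open>e\<close> brings the whole range into \<open>univ M\<close>.\<close>
        define w' where "w' j = (if j \<le> i \<or> j \<in> fv (conjs \<phi>s) then w j else e)" for j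
        have "sat M w' (conjs \<phi>s)"
          using w(3) by (subst sat_cong[of _ _ w]) (auto simp: w'_def)
        moreover have wj: "w j = (v(i := d)) j" if "j \<le> i" for j
          using w(2)[of j] that nth[of j d] js by simp
        moreover have "w j \<in> univ M" if "j \<in> fv (conjs \<phi>s)" for j
        proof (cases "j \<le> i")
          case True then show ?thesis using wj vd by simp
        next
          case False
          then have "j \<in> set ?js" using that js by simp
          then show ?thesis using w(1) by blast
        qed
        ultimately show ?r
          using vd e by (intro exI[of _ w']) (auto simp: w'_def sat_conj[OF ne])
      next
        assume ?r
        then obtain w where w: "range w \<subseteq> univ M" "\<And>j. j \<le> i \<Longrightarrow> w j = (v(i := d)) j"
          "sat M w (conjs \<phi>s)" by (auto simp: sat_conj[OF ne] less_Suc_eq_le)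
        define w' where "w' j = (if j \<in> set ?js then w j else (d # l) ! \<sigma> j)" for j
        have "sat M w' (conjs \<phi>s)"
        proof (subst sat_cong[of _ _ w])
          fix j assume "j \<in> fv (conjs \<phi>s)"
          then show "w' j = w j" using js nth[of j d] w(2)[of j] by (auto simp: w'_def)
        qed (rule w(3))
        then show ?l unfolding * using w(1) by (intro exI[of _ w']) (auto simp: w'_def)
      qed
    qed
    have fvE: "fv (E \<phi>s) \<subseteq> {..<Suc i}" for \<phi>s
      by (auto simp: E_def Let_def fv_rename fv_exs finite_fv \<sigma>_def)
    have wfE: "set \<phi>s \<subseteq> \<Theta> \<Longrightarrow> wf_fm L (E \<phi>s)" for \<phi>s
      using wf by (auto simp: E_def Let_def wf_rename wf_exs wf_conj)
    have "p \<subseteq> formulas_over L (set l) 1"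
      using fvE wfE l(1) by (auto simp: p_def formulas_over_def formulas_def)
    moreover have "consistent M 1 p"
      unfolding consistent_def
    proof (intro allI impI, elim conjE)
      fix q assume q: "finite q" "q \<subseteq> p"
      have "\<forall>x\<in>q. \<exists>\<phi>s. set \<phi>s \<subseteq> \<Theta> \<and> x = (E \<phi>s, l)" using q(2) by (auto simp: p_def)
      then obtain f where f: "\<And>x. x \<in> q \<Longrightarrow> set (f x) \<subseteq> \<Theta> \<and> x = (E (f x), l)" by metis
      \<comment> \<open>One assignment satisfies the formulas of all the lists behind
        \<open>q\<close>, so its value at \<open>i\<close> realises every member of \<open>q\<close>
        at once.\<close>
      have "finite (\<Union>x\<in>q. set (f x))" "(\<Union>x\<in>q. set (f x)) \<subseteq> \<Theta>" using q(1) f by auto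
      then obtain w where w: "range w \<subseteq> univ M" "\<And>j. j < i \<Longrightarrow> w j = v j"
        "\<And>\<theta>. \<theta> \<in> (\<Union>x\<in>q. set (f x)) \<Longrightarrow> sat M w \<theta>" using Iv unfolding I_def by meson
      have wi: "w i \<in> univ M" using w(1) by auto
      have "[w i] \<in> solutions M 1 \<phi> c" if "(\<phi>, c) \<in> q" for \<phi> c
      proof -
        have "holds M (E (f (\<phi>, c))) (w i # l)"
          unfolding E[OF wi] using w that by (intro exI[of _ w]) (auto simp: less_Suc_eq)
        then show ?thesis using f[OF that] wi by (auto simp: solutions_def tuples_def)
      qed
      then show "realised M 1 q"
        unfolding realised_def using wi by (intro bexI[of _ "[w i]"]) (auto simp: tuples_def)
    qed
    moreover have "|set l| <o \<kappa>"
      using inf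
      by (meson List.finite_set finite_iff_ordLess_natLeq ordLess_transitive)
    ultimately have "realised M 1 p" using sat l(2) unfolding saturated_def by blast
    then obtain b where b: "b \<in> tuples M 1" "\<And>\<phi> c. (\<phi>, c) \<in> p \<Longrightarrow> b \<in> solutions M 1 \<phi> c"
      unfolding realised_def by blast
    then obtain d where d: "b = [d]" "d \<in> univ M"
      by (auto simp: tuples_def length_Suc_conv)
    have "I (Suc i) (v(i := d))"
      unfolding I_def
    proof (intro conjI allI impI)
      show "(v(i := d)) ` {..<Suc i} \<subseteq> univ M" using Iv d by (auto simp: I_def less_Suc_eq)
      fix \<Phi> assume \<Phi>: "finite \<Phi> \<and> \<Phi> \<subseteq> \<Theta>"
      then obtain \<phi>s where \<phi>s: "set \<phi>s = \<Phi>" using finite_list by blast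
      then have "(E \<phi>s, l) \<in> p" using \<Phi> by (auto simp: p_def)
      then have "holds M (E \<phi>s) (d # l)" using b(2) d by (auto simp: solutions_def)
      then show "\<exists>w. range w \<subseteq> univ M \<and> (\<forall>j<Suc i. w j = (v(i := d)) j) \<and> (\<forall>\<theta>\<in>\<Phi>. sat M w \<theta>)"
        unfolding E[OF d(2)] \<phi>s .
    qed
    then show ?thesis ..
  qed
  have "\<exists>V. \<forall>i. I i (V i) \<and> (\<exists>d. V (Suc i) = (V i)(i := d))"
  proof (rule dependent_nat_choice)
    show "\<exists>v. I 0 v" using fin by (auto simp: I_def)
  next
    fix v i assume "I i v"
    then show "\<exists>w. I (Suc i) w \<and> (\<exists>d. w = v(i := d))" using step by blast
  qed
  then obtain V where V: "\<And>i. I i (V i)" "\<And>i. \<exists>d. V (Suc i) = (V i)(i := d)" by blast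
  \<comment> \<open>Stage \<open>i\<close> changes only the value at \<open>i\<close>, so each value
    is settled from stage \<open>Suc i\<close> on and the diagonal is the limit of the
    \<open>V i\<close>.\<close>
  define w where "w i = V (Suc i) i" for i
  have Vw: "j < i \<Longrightarrow> V i j = w j" for i j
  proof (induction i)
    case (Suc i)
    then show ?case using V(2)[of i] by (cases "j = i") (auto simp: w_def)
  qed simp
  have "range w \<subseteq> univ M" using V(1) by (force simp: w_def I_def)
  moreover have "sat M w \<theta>" if "\<theta> \<in> \<Theta>" for \<theta>
  proof -
    \<comment> \<open>A formula has finitely many variables, so a stage past all of them decides it:
      \<open>u\<close> agrees with \<open>w\<close> on \<open>fv \<theta>\<close>.\<close>
    obtain i where i: "\<And>j. j \<in> fv \<theta> \<Longrightarrow> j < i"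
      using finite_fv[of \<theta>] by (meson finite_nat_set_iff_bounded)
    obtain u where u: "\<And>j. j < i \<Longrightarrow> u j = V i j" "sat M u \<theta>"
      using V(1)[of i, unfolded I_def, THEN conjunct2, rule_format, of "{\<theta>}"] \<open>\<theta> \<in> \<Theta>\<close> by auto
    have "sat M u \<theta> \<longleftrightarrow> sat M w \<theta>" by (rule sat_cong) (simp only: u(1)[OF i] Vw[OF i])
    then show ?thesis using u(2) by simp
  qed
  ultimately show ?thesis by blast
qed


section \<open>Finite arrays\<close>

text \<open>An infinite array is one assignment to countably many variables. Disjointness within
  rows and a common solution along every finite partial path are first-order conditions on it.
  Finitely many of them concern finitely many rows, so a deep enough given array meets them and
  compactness applies.\<close>

lemma TP2_if_deep_arrays:
  fixes M :: "('f, 'r, 'a) fo_structure"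
  assumes sat: "saturated L \<kappa> M" "natLeq <o \<kappa>" and ne: "univ M \<noteq> {}"
    and \<psi>: "\<psi> \<in> formulas L (n + m)"
    and arr: "\<And>N :: nat. \<exists>a :: nat \<Rightarrow> nat \<Rightarrow> 'a list. (\<forall>i j. a i j \<in> tuples M m) \<and>
      (\<forall>i<N. \<forall>j j'. j \<noteq> j' \<longrightarrow> solutions M n \<psi> (a i j) \<inter> solutions M n \<psi> (a i j') = {}) \<and>
      (\<forall>f. tuples M n \<inter> (\<Inter>i<N. solutions M n \<psi> (a i (f i))) \<noteq> {})"
  shows "TP2 M n m \<psi>"
proof -
  \<comment> \<open>Variables \<open>0, \<dots>, n - 1\<close> are reserved for the bound tuple \<open>x\<close>; the array entry with code \<open>p\<close>
    occupies the \<open>p\<close>-th block of length \<open>m\<close> after them.\<close>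
  define c where "c w p = map w [n + p * m..<n + p * m + m]" for w :: "nat \<Rightarrow> 'a" and p
  define \<sigma> where "\<sigma> p l = (if l < n then l else l + p * m)" for p l :: nat
  define D where "D F = exs [0..<n] (conjs (map (\<lambda>p. rename (\<sigma> p) \<psi>) (sorted_list_of_set F)))"
    for F :: "nat set"
  define row where "row p = fst (prod_decode p)" for p
  \<comment> \<open>\<open>D F\<close> says that the entries coded in \<open>F\<close> have a common
    solution; injectivity of \<open>row\<close> on \<open>F\<close> means that \<open>F\<close> is a
    finite partial path, with at most one entry per row.\<close>
  define \<Theta> where "\<Theta> = {D F | F. finite F \<and> inj_on row F} \<union>
    {Neg (D {p, q}) | p q. p \<noteq> q \<and> row p = row q}"
  have pathI: "D F \<in> \<Theta>" if "finite F" "inj_on row F" for F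
    using that unfolding \<Theta>_def by blast
  have rowI: "Neg (D {p, q}) \<in> \<Theta>" if "p \<noteq> q" "row p = row q" for p q
    using that unfolding \<Theta>_def by blast
  have wf: "wf_fm L \<theta>" if "\<theta> \<in> \<Theta>" for \<theta>
    using that \<psi> by (auto simp: \<Theta>_def D_def wf_exs wf_conj wf_rename formulas_def)
  have c: "c w p \<in> tuples M m" if "range w \<subseteq> univ M" for w p
    using that by (auto simp: c_def tuples_def)
  have D: "sat M w (D F) \<longleftrightarrow> tuples M n \<inter> (\<Inter>p\<in>F. solutions M n \<psi> (c w p)) \<noteq> {}"
    (is "?l \<longleftrightarrow> ?r") if F: "finite F" and w: "range w \<subseteq> univ M" for F w
  proof -
    have *: "sat M u (rename (\<sigma> p) \<psi>) \<longleftrightarrow> map u [0..<n] \<in> solutions M n \<psi> (c w p)"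
      if u: "\<And>i. n \<le> i \<Longrightarrow> u i = w i" "u ` {0..<n} \<subseteq> univ M" for u p
    proof -
      have "sat M (\<lambda>i. u (\<sigma> p i)) \<psi> \<longleftrightarrow> sat M ((!) (map u [0..<n] @ c w p)) \<psi>"
        using \<psi> u(1) by (intro sat_cong) (auto simp: formulas_def \<sigma>_def c_def nth_append
            subset_iff algebra_simps)
      then show ?thesis using u(2) by (auto simp: sat_rename solutions_def holds_def tuples_def)
    qed
    show ?thesis
    proof
      assume ?l
      then obtain u where u: "u ` {0..<n} \<subseteq> univ M" "\<And>i. n \<le> i \<Longrightarrow> u i = w i"
        "\<And>p. p \<in> F \<Longrightarrow> sat M u (rename (\<sigma> p) \<psi>)"
        unfolding D_def sat_exs by (auto simp: sat_conj[OF ne] F)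
      then have "map u [0..<n] \<in> tuples M n \<inter> (\<Inter>p\<in>F. solutions M n \<psi> (c w p))"
        using * by (auto simp: tuples_def)
      then show ?r by blast
    next
      assume ?r
      then obtain x where x: "x \<in> tuples M n" "\<And>p. p \<in> F \<Longrightarrow> x \<in> solutions M n \<psi> (c w p)" by blast
      define u where "u i = (if i < n then x ! i else w i)" for i
      have "map u [0..<n] = x" "u ` {0..<n} \<subseteq> univ M"
        using x(1) by (auto simp: u_def tuples_def intro!: nth_equalityI)
      then show ?l
        unfolding D_def sat_exs using x(2) *[of u]
        by (intro exI[of _ u]) (auto simp: sat_conj[OF ne] F u_def)
    qed
  qed
  have fin: "\<exists>w. range w \<subseteq> univ M \<and> (\<forall>\<theta>\<in>\<Phi>. sat M w \<theta>)" if \<Phi>: "finite \<Phi>" "\<Phi> \<subseteq> \<Theta>" for \<Phi>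
  proof -
    have "\<exists>F. finite F \<and> ((\<theta> = D F \<and> inj_on row F) \<or>
        (\<exists>p q. F = {p, q} \<and> \<theta> = Neg (D F) \<and> p \<noteq> q \<and> row p = row q))" if \<theta>: "\<theta> \<in> \<Theta>" for \<theta>
    proof -
      from \<theta> consider F where "\<theta> = D F" "finite F" "inj_on row F"
        | p q where "\<theta> = Neg (D {p, q})" "p \<noteq> q" "row p = row q"
        unfolding \<Theta>_def by blast
      then show ?thesis
      proof cases
        case 1
        then show ?thesis by blast
      next
        case (2 p q)
        then show ?thesis by (intro exI[of _ "{p, q}"] conjI disjI2 exI[of _ p] exI[of _ q]) simp_all
      qed
    qed
    then obtain F where F: "\<And>\<theta>. \<theta> \<in> \<Theta> \<Longrightarrow> finite (F \<theta>) \<and> ((\<theta> = D (F \<theta>) \<and> inj_on row (F \<theta>)) \<or>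
        (\<exists>p q. F \<theta> = {p, q} \<and> \<theta> = Neg (D (F \<theta>)) \<and> p \<noteq> q \<and> row p = row q))"
      by metis
    \<comment> \<open>Only finitely many codes occur in \<open>\<Phi>\<close>; \<open>N\<close>
      exceeds their rows, so an array with \<open>N\<close> good rows suffices.\<close>
    have "finite (row ` (\<Union>\<theta>\<in>\<Phi>. F \<theta>))" using \<Phi> F by blast
    then obtain N where "\<forall>i\<in>row ` (\<Union>\<theta>\<in>\<Phi>. F \<theta>). i < N" by (meson finite_nat_set_iff_bounded)
    then have N: "\<And>\<theta> p. \<theta> \<in> \<Phi> \<Longrightarrow> p \<in> F \<theta> \<Longrightarrow> row p < N" by blast
    obtain a :: "nat \<Rightarrow> nat \<Rightarrow> 'a list" where "\<forall>i j. a i j \<in> tuples M m"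
      "\<forall>i<N. \<forall>j j'. j \<noteq> j' \<longrightarrow>
         solutions M n \<psi> (a i j) \<inter> solutions M n \<psi> (a i j') = {}"
      "\<forall>f. tuples M n \<inter> (\<Inter>i<N. solutions M n \<psi> (a i (f i))) \<noteq> {}"
      using arr[of N] by (elim exE conjE that)
    note a = this[rule_format]
    obtain e where e: "e \<in> univ M" using ne by blast
    \<comment> \<open>This inverts the block layout. The default \<open>e\<close> fills the reserved
      variables, and all variables when \<open>m = 0\<close> and the entries are empty.\<close>
    define w where "w i = (if n \<le> i \<and> 0 < m
      then case_prod a (prod_decode ((i - n) div m)) ! ((i - n) mod m) else e)" for i
    have len: "length (a i j) = m" for i j
      using a(1) by (simp add: tuples_def)
    have el: "a i j ! k \<in> univ M" if "k < m" for i j k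
      using a(1)[of i j] that by (auto simp: tuples_def)
    have w: "range w \<subseteq> univ M"
      using e el by (auto simp: w_def split: prod.split)
    have cw: "c w p = case_prod a (prod_decode p)" for p
      by (rule nth_equalityI) (auto simp: c_def w_def len split: prod.split)
    have "sat M w \<theta>" if "\<theta> \<in> \<Phi>" for \<theta>
    proof -
      have "\<theta> \<in> \<Theta>" using that \<Phi> by blast
      note F = F[OF this]
      from F consider "\<theta> = D (F \<theta>)" "inj_on row (F \<theta>)"
        | p q where "F \<theta> = {p, q}" "\<theta> = Neg (D (F \<theta>))" "p \<noteq> q" "row p = row q" by blast
      then show ?thesis
      proof cases
        case 1
        \<comment> \<open>A full path through the entries coded in \<open>F \<theta>\<close>: a
          common solution along its first \<open>N\<close> rows solves all of these entries.\<close>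
        define f where "f i = snd (prod_decode (the_inv_into (F \<theta>) row i))" for i
        have "c w p = a (row p) (f (row p))" if "p \<in> F \<theta>" for p
          using the_inv_into_f_f[OF 1(2) that] by (simp add: f_def cw case_prod_beta) (simp add: row_def)
        then have "(\<Inter>i<N. solutions M n \<psi> (a i (f i))) \<subseteq> (\<Inter>p\<in>F \<theta>. solutions M n \<psi> (c w p))"
          using N[OF that] by auto
        then have "sat M w (D (F \<theta>))"
          using D[of "F \<theta>" w] F w a(3)[of f] by blast
        then show ?thesis using 1(1) by simp
      next
        case 2
        have "snd (prod_decode p) \<noteq> snd (prod_decode q)"
          using 2(3,4) by (metis prod_decode_eq prod_eq_iff row_def)
        then have "solutions M n \<psi> (c w p) \<inter> solutions M n \<psi> (c w q) = {}"
          using a(2)[of "row p" "snd (prod_decode p)" "snd (prod_decode q)"] N[OF that, of p] 2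
          by (simp add: cw row_def case_prod_beta)
        then have "\<not> sat M w (D (F \<theta>))"
          using D[of "F \<theta>" w] F w unfolding 2(1) by auto
        then show ?thesis using 2(2) by (metis sat.simps(3))
      qed
    qed
    then show ?thesis using w by blast
  qed
  have "\<exists>w. range w \<subseteq> univ M \<and> (\<forall>\<theta>\<in>\<Theta>. sat M w \<theta>)"
    by (rule saturated_assignment[OF sat ne]) (fact wf, fact fin)
  then obtain w where w: "range w \<subseteq> univ M" "\<And>\<theta>. \<theta> \<in> \<Theta> \<Longrightarrow> sat M w \<theta>" by blast
  define a where "a i j = c w (prod_encode (i, j))" for i j
  have "k_inconsistent M n 2 (\<lambda>j. (\<psi>, a i j))" for i
    unfolding k_inconsistent_def
  proof (intro allI impI notI)
    fix J :: "nat set" assume J: "finite J \<and> card J = 2" and con: "consistent M n ((\<lambda>j. (\<psi>, a i j)) ` J)"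
    obtain j j' where jj: "J = {j, j'}" "j \<noteq> j'" using J by (meson card_2_iff)
    let ?p = "prod_encode (i, j)" and ?q = "prod_encode (i, j')"
    have "Neg (D {?p, ?q}) \<in> \<Theta>" using jj(2) by (intro rowI) (auto simp: row_def)
    then have "\<not> sat M w (D {?p, ?q})" using w(2) by fastforce
    then have *: "tuples M n \<inter> (solutions M n \<psi> (a i j) \<inter> solutions M n \<psi> (a i j')) = {}"
      using D[of "{?p, ?q}" w] w(1) by (simp add: a_def)
    have "realised M n ((\<lambda>j. (\<psi>, a i j)) ` J)" using con J unfolding consistent_def by blast
    then show False using * unfolding realised_def jj(1) by auto
  qed
  moreover have "consistent M n (range (\<lambda>i. (\<psi>, a i (f i))))" for f
    unfolding consistent_def
  proof (intro allI impI, elim conjE)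
    fix q assume q: "finite q" "q \<subseteq> range (\<lambda>i. (\<psi>, a i (f i)))"
    then obtain J where J: "finite J" "q = (\<lambda>i. (\<psi>, a i (f i))) ` J" by (meson finite_subset_image)
    define F where "F = (\<lambda>i. prod_encode (i, f i)) ` J"
    have F: "finite F" "D F \<in> \<Theta>" using J(1) by (auto intro!: pathI simp: F_def row_def inj_on_def)
    then have "tuples M n \<inter> (\<Inter>p\<in>F. solutions M n \<psi> (c w p)) \<noteq> {}"
      using D[of F w] w by blast
    then show "realised M n q" unfolding realised_def J(2) F_def a_def by auto
  qed
  ultimately show ?thesis
    unfolding TP2_def using c[OF w(1)] by (intro exI[of _ a] exI[of _ 2]) (auto simp: a_def)
qed


section \<open>Cosets\<close>

text \<open>Restricting the carrier keeps the multiplication of \<open>G\<close>, so only the range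
  of the representatives changes.\<close>

lemma finite_index_iff: "finite_index G H K \<longleftrightarrow> finite ((\<lambda>h. K #>\<^bsub>G\<^esub> h) ` H)"
proof -
  have "rcosets\<^bsub>G\<lparr>carrier := H\<rparr>\<^esub> K = (\<lambda>h. K #>\<^bsub>G\<^esub> h) ` H"
    by (auto simp: RCOSETS_def r_coset_def)
  then show ?thesis by (simp add: finite_index_def)
qed

context group
begin

lemma finite_index_refl:
  assumes "subgroup H G"
  shows "finite_index G H H"
proof -
  have "(\<lambda>h. H #> h) ` H \<subseteq> {H}" using assms by (auto simp: coset_join2 subgroup.mem_carrier)
  then show ?thesis unfolding finite_index_iff by (rule finite_subset) simp
qed

text \<open>Take finitely many representatives \<open>T\<close> of the cosets of \<open>L\<close>
  that meet \<open>H\<close>. Writing \<open>h = l \<otimes> t\<close> gives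
  \<open>K #> h = (K #> l) #> t\<close>, and only finitely many pairs of \<open>K #> l\<close> and
  \<open>t\<close> occur.\<close>

lemma finite_index_trans:
  assumes "subgroup L G" "K \<subseteq> carrier G" "H \<subseteq> carrier G"
    and "finite_index G H L" "finite_index G L K"
  shows "finite_index G H K"
proof -
  obtain T where T: "T \<subseteq> H" "finite T" "(\<lambda>h. L #> h) ` H = (\<lambda>h. L #> h) ` T"
    using assms(4) finite_subset_image[of "(\<lambda>h. L #> h) ` H" "\<lambda>h. L #> h" H]
    unfolding finite_index_iff by blast
  have "K #> h \<in> (\<lambda>(A, t). A #> t) ` (((\<lambda>l. K #> l) ` L) \<times> T)" if h: "h \<in> H" for h
  proof -
    obtain t where t: "t \<in> T" "L #> h = L #> t" using T(3) h by blast
    have "h \<in> L #> t" using rcos_self[of h L] assms(1,3) h t(2) by auto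
    then obtain l where l: "l \<in> L" "h = l \<otimes> t" by (auto simp: r_coset_def)
    have "K #> h = (K #> l) #> t"
      using l t T(1) assms(1-3) by (simp add: coset_mult_assoc subgroup.mem_carrier subset_iff)
    then show ?thesis using l(1) t(1) by auto
  qed
  then have "(\<lambda>h. K #> h) ` H \<subseteq> (\<lambda>(A, t). A #> t) ` (((\<lambda>l. K #> l) ` L) \<times> T)" by blast
  then show ?thesis
    using assms(5) T(2) unfolding finite_index_iff by (meson finite_SigmaI finite_imageI finite_subset)
qed

text \<open>For \<open>h\<close> in the subgroup \<open>D\<close>, a product
  \<open>k \<otimes> h\<close> lies in \<open>D\<close> exactly when \<open>k\<close> does.\<close>

lemma r_coset_Int:
  assumes "subgroup D G" "H \<subseteq> carrier G" "h \<in> D"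
  shows "(D \<inter> H) #> h = (H #> h) \<inter> D"
proof
  show "(D \<inter> H) #> h \<subseteq> (H #> h) \<inter> D"
    using assms by (auto simp: r_coset_def subgroup.m_closed)
  show "(H #> h) \<inter> D \<subseteq> (D \<inter> H) #> h"
  proof
    fix x assume x: "x \<in> (H #> h) \<inter> D"
    then obtain k where k: "k \<in> H" "x = k \<otimes> h" by (auto simp: r_coset_def)
    have "h \<in> carrier G" "k \<in> carrier G" using assms k by (auto dest: subgroup.mem_carrier)
    then have "k = x \<otimes> inv h" using k(2) by (simp add: m_assoc)
    then have "k \<in> D" using x assms by (auto intro: subgroup.m_closed subgroup.m_inv_closed)
    then show "x \<in> (D \<inter> H) #> h" using k by (auto simp: r_coset_def)
  qed
qed

text \<open>Intersecting with \<open>D\<close> maps the cosets of \<open>H\<close> with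
  representative in \<open>D\<close> onto those of \<open>D \<inter> H\<close>, so there are
  infinitely many of the former too.\<close>

lemma infinite_index_sequence:
  assumes "subgroup D G" "H \<subseteq> carrier G" "\<not> finite_index G D (D \<inter> H)"
  shows "\<exists>b :: nat \<Rightarrow> 'a. range b \<subseteq> D \<and> inj (\<lambda>j. H #> b j)"
proof -
  have "(\<lambda>h. (D \<inter> H) #> h) ` D = (\<lambda>A. A \<inter> D) ` (\<lambda>h. H #> h) ` D"
    unfolding image_image using r_coset_Int[OF assms(1,2)] by (rule image_cong[OF refl])
  then have "infinite ((\<lambda>h. H #> h) ` D)"
    using assms(3) unfolding finite_index_iff by (metis finite_imageI)
  then obtain f :: "nat \<Rightarrow> 'a set" where f: "inj f" "range f \<subseteq> (\<lambda>h. H #> h) ` D"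
    using infinite_countable_subset by blast
  have "\<forall>j. \<exists>b. b \<in> D \<and> f j = H #> b" using f(2) by blast
  then obtain b where "\<And>j. b j \<in> D \<and> f j = H #> b j" by metis
  then show ?thesis using f(1) by (intro exI[of _ b]) (auto simp: inj_def)
qed

text \<open>The representative is the product of the \<open>b i\<close>: modulo \<open>H i\<close> all factors but \<open>b i\<close> vanish.\<close>

lemma ex_common_coset_representative:
  assumes "finite I" "I \<subseteq> J" "\<And>i. i \<in> J \<Longrightarrow> H i \<lhd> G"
    and "\<And>i. i \<in> I \<Longrightarrow> b i \<in> carrier G"
    and "\<And>i l. i \<in> I \<Longrightarrow> l \<in> J \<Longrightarrow> l \<noteq> i \<Longrightarrow> b i \<in> H l"
  shows "\<exists>x\<in>carrier G. (\<forall>i\<in>I. H i #> x = H i #> b i) \<and> (\<forall>l\<in>J - I. x \<in> H l)"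
  using assms
proof (induction I rule: finite_induct)
  case empty
  then have "\<forall>l\<in>J. \<one> \<in> H l" by (meson normal_imp_subgroup subgroup.one_closed)
  then show ?case by auto
next
  case (insert j I)
  have "\<exists>x\<in>carrier G. (\<forall>i\<in>I. H i #> x = H i #> b i) \<and> (\<forall>l\<in>J - I. x \<in> H l)"
    by (rule insert.IH) (use insert.prems in auto)
  then obtain x where x: "x \<in> carrier G" "\<And>i. i \<in> I \<Longrightarrow> H i #> x = H i #> b i"
    "\<And>l. l \<in> J \<Longrightarrow> l \<notin> I \<Longrightarrow> x \<in> H l" by auto
  have j: "j \<in> J" "b j \<in> carrier G" "\<And>l. l \<in> J \<Longrightarrow> l \<noteq> j \<Longrightarrow> b j \<in> H l"
    using insert.prems by auto
  \<comment> \<open>Normality enters here: cosets of \<open>H i\<close> multiply like their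
    representatives.\<close>
  have mult: "H i #> (u \<otimes> v) = (H i #> u) <#> (H i #> v)"
    if "i \<in> J" "u \<in> carrier G" "v \<in> carrier G" for i u v
    using normal.rcos_sum[OF insert.prems(2)] that by simp
  have absorb: "H i #> u = H i #> \<one>" if "i \<in> J" "u \<in> H i" for i u
    using that insert.prems(2)[OF that(1)]
    by (metis coset_join2 coset_mult_one normal_imp_subgroup subgroup.mem_carrier subgroup.subset)
  have "H i #> (x \<otimes> b j) = H i #> b i" if "i \<in> insert j I" for i
  proof (cases "i = j")
    case True
    \<comment> \<open>As \<open>j\<close> is not in \<open>I\<close>, the membership clause of the
      induction hypothesis gives \<open>x \<in> H j\<close>, and the left factor vanishes modulo
      \<open>H j\<close>.\<close>
    have "H j #> (x \<otimes> b j) = H j #> (\<one> \<otimes> b j)"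
      using x j insert.hyps absorb[of j x] mult[of j x "b j"] mult[of j \<one> "b j"]
      by (simp del: l_one)
    then show ?thesis using True j by simp
  next
    case False
    then have i: "i \<in> I" "i \<in> J" using that insert.prems(1) by auto
    \<comment> \<open>Here the right factor vanishes, because \<open>b j \<in> H i\<close>.\<close>
    have "H i #> (x \<otimes> b j) = H i #> (x \<otimes> \<one>)"
      using x(1) j(2) i absorb[of i "b j"] j(3)[OF i(2) False]
        mult[of i x "b j"] mult[of i x \<one>] by (simp del: r_one)
    then show ?thesis using x(1,2) i(1) by simp
  qed
  moreover have "x \<otimes> b j \<in> H l" if "l \<in> J - insert j I" for l
    using that x(3)[of l] j(3)[of l] insert.prems(2)[of l]
    by (simp add: subgroup.m_closed normal_imp_subgroup)
  ultimately show ?case using x(1) j(2) by blast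
qed

end


section \<open>Intersections of definable normal subgroups\<close>

text \<open>A point \<open>x\<close> lies in the coset iff \<open>h \<otimes> b = x\<close> for some
  solution \<open>h\<close> of \<open>\<phi>\<close> at \<open>a\<close>, which the graph of the
  multiplication expresses. The parameters \<open>d\<close> of that graph do not depend on
  \<open>a\<close> and \<open>b\<close>, so one formula serves all cosets.\<close>

lemma coset_formula:
  fixes M :: "('f, 'r, 'a) fo_structure" and G :: "'a list monoid"
  assumes G: "definable_group L M n G" and \<phi>: "\<phi> \<in> formulas L (n + m)"
  shows "\<exists>\<psi> d. set d \<subseteq> univ M \<and> \<psi> \<in> formulas L (n + (m + n + length d)) \<and>
    (\<forall>a\<in>tuples M m. \<forall>b\<in>carrier G. solutions M n \<phi> a \<subseteq> carrier G \<longrightarrow>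
       solutions M n \<psi> (a @ b @ d) = solutions M n \<phi> a #>\<^bsub>G\<^esub> b)"
proof -
  interpret group G using G by (simp add: definable_group_def)
  have carr: "carrier G \<subseteq> tuples M n"
    using G unfolding definable_group_def definable_def solutions_def by blast
  obtain \<theta> d where d: "set d \<subseteq> univ M" and \<theta>: "\<theta> \<in> formulas L (n + n + n + length d)"
    and graph: "{x @ y @ (x \<otimes>\<^bsub>G\<^esub> y) |x y. x \<in> carrier G \<and> y \<in> carrier G}
      = solutions M (n + n + n) \<theta> d"
    using G unfolding definable_group_def definable_def formulas_over_def by auto
  \<comment> \<open>The variables of \<open>\<psi>\<close> are laid out as \<open>x, a, b, d\<close>, followed from \<open>K\<close> on by the quantified
    \<open>h \<in> H a\<close> with \<open>h \<otimes> b = x\<close>.\<close>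
  define K where "K = n + (m + n + length d)"
  define \<sigma> where "\<sigma> l = (if l < n then K + l else l)" for l
  \<comment> \<open>The blocks of \<open>\<theta>\<close> are \<open>h, b, x, d\<close>;
    \<open>\<tau>\<close> moves them to the starting positions \<open>K\<close>,
    \<open>n + m\<close>, \<open>0\<close> and \<open>n + m + n\<close>.\<close>
  define \<tau> where "\<tau> l = (if l < n then K + l else if l < n + n then l + m
    else if l < n + n + n then l - n - n else l - n + m)" for l
  define \<psi> where "\<psi> = exs [K..<K + n] (And (rename \<sigma> \<phi>) (rename \<tau> \<theta>))"
  have "\<psi> \<in> formulas L K"
    using \<phi> \<theta> by (auto simp: \<psi>_def formulas_def wf_exs wf_rename fv_exs fv_rename \<sigma>_def \<tau>_def K_def)
  moreover have "solutions M n \<psi> (a @ b @ d) = solutions M n \<phi> a #>\<^bsub>G\<^esub> b"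
    if a: "a \<in> tuples M m" and b: "b \<in> carrier G" and sub: "solutions M n \<phi> a \<subseteq> carrier G" for a b
  proof -
    have len: "length a = m" "length b = n" using a b carr by (auto simp: tuples_def)
    have *: "holds M \<psi> (x @ a @ b @ d) \<longleftrightarrow>
        (\<exists>h\<in>tuples M n. holds M \<phi> (h @ a) \<and> holds M \<theta> (h @ b @ x @ d))" (is "?l \<longleftrightarrow> ?r")
      if x: "x \<in> tuples M n" for x
    proof -
      have lx: "length x = n" using x by (simp add: tuples_def)
      have \<sigma>: "sat M w (rename \<sigma> \<phi>) \<longleftrightarrow> holds M \<phi> (map w [K..<K + n] @ a)"
        if w: "\<And>i. i < K \<Longrightarrow> w i = (x @ a @ b @ d) ! i" for w
        unfolding sat_rename holds_def
      proof (rule sat_cong)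
        fix l assume "l \<in> fv \<phi>"
        then have "l < n + m" using \<phi> by (auto simp: formulas_def)
        then show "w (\<sigma> l) = (map w [K..<K + n] @ a) ! l"
          using len lx by (auto simp: \<sigma>_def w K_def nth_append)
      qed
      have \<tau>: "sat M w (rename \<tau> \<theta>) \<longleftrightarrow> holds M \<theta> (map w [K..<K + n] @ b @ x @ d)"
        if w: "\<And>i. i < K \<Longrightarrow> w i = (x @ a @ b @ d) ! i" for w
        unfolding sat_rename holds_def
      proof (rule sat_cong)
        fix l assume "l \<in> fv \<theta>"
        then have "l < n + n + n + length d" using \<theta> by (auto simp: formulas_def)
        then consider "l < n" | k where "l = n + k" "k < n" | k where "l = n + n + k" "k < n"
          | k where "l = n + n + n + k" "k < length d"
          by (metis add.assoc le_add_diff_inverse nat_add_left_cancel_less not_less)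
        then show "w (\<tau> l) = (map w [K..<K + n] @ b @ x @ d) ! l"
          using len lx by cases (auto simp: \<tau>_def w K_def nth_append)
      qed
      show ?thesis
      proof
        assume ?l
        then obtain w where w: "w ` {K..<K + n} \<subseteq> univ M" "\<And>i. i < K \<Longrightarrow> w i = (x @ a @ b @ d) ! i"
          "sat M w (rename \<sigma> \<phi>)" "sat M w (rename \<tau> \<theta>)"
          unfolding \<psi>_def holds_def sat_exs by auto
        then show ?r
          using \<sigma>[of w] \<tau>[of w] by (intro bexI[of _ "map w [K..<K + n]"]) (auto simp: tuples_def)
      next
        assume ?r
        then obtain h where h: "h \<in> tuples M n" "holds M \<phi> (h @ a)" "holds M \<theta> (h @ b @ x @ d)"
          by blast
        define w where "w i = (if i \<in> {K..<K + n} then h ! (i - K) else (x @ a @ b @ d) ! i)" for i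
        have "map w [K..<K + n] = h"
          using h(1) by (auto simp: w_def tuples_def intro!: nth_equalityI)
        moreover have "h ! k \<in> univ M" if "k < n" for k
          using h(1) that by (auto simp: tuples_def)
        then have "w ` {K..<K + n} \<subseteq> univ M" by (auto simp: w_def)
        moreover have "\<And>i. i < K \<Longrightarrow> w i = (x @ a @ b @ d) ! i" by (simp add: w_def)
        ultimately show ?l
          unfolding \<psi>_def holds_def sat_exs using \<sigma>[of w] \<tau>[of w] h(2,3)
          by (intro exI[of _ w]) (auto simp: w_def)
      qed
    qed
    have graph_iff: "holds M \<theta> (h @ b @ x @ d) \<longleftrightarrow> h \<in> carrier G \<and> x = h \<otimes>\<^bsub>G\<^esub> b"
      if h: "h \<in> tuples M n" and x: "x \<in> tuples M n" for h x
    proof -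
      have "holds M \<theta> (h @ b @ x @ d) \<longleftrightarrow> h @ b @ x \<in> solutions M (n + n + n) \<theta> d"
        using h x b carr by (auto simp: solutions_def tuples_def)
      also have "\<dots> \<longleftrightarrow> h \<in> carrier G \<and> x = h \<otimes>\<^bsub>G\<^esub> b"
      proof
        assume "h @ b @ x \<in> solutions M (n + n + n) \<theta> d"
        then obtain y z where yz: "h @ b @ x = y @ z @ (y \<otimes>\<^bsub>G\<^esub> z)" "y \<in> carrier G" "z \<in> carrier G"
          unfolding graph[symmetric] by blast
        have "length y = n" "length z = n" using yz(2,3) carr by (auto simp: tuples_def)
        then show "h \<in> carrier G \<and> x = h \<otimes>\<^bsub>G\<^esub> b" using yz h len by (auto simp: tuples_def)
      next
        assume "h \<in> carrier G \<and> x = h \<otimes>\<^bsub>G\<^esub> b"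
        then show "h @ b @ x \<in> solutions M (n + n + n) \<theta> d"
          unfolding graph[symmetric] using b by blast
      qed
      finally show ?thesis .
    qed
    show ?thesis
    proof (intro subset_antisym subsetI)
      fix x assume "x \<in> solutions M n \<psi> (a @ b @ d)"
      then have x: "x \<in> tuples M n" and "holds M \<psi> (x @ a @ b @ d)" by (auto simp: solutions_def)
      then obtain h where "h \<in> tuples M n" "holds M \<phi> (h @ a)" "x = h \<otimes>\<^bsub>G\<^esub> b"
        using *[OF x] graph_iff[OF _ x] by blast
      then show "x \<in> solutions M n \<phi> a #>\<^bsub>G\<^esub> b" by (auto simp: r_coset_def solutions_def)
    next
      fix x assume "x \<in> solutions M n \<phi> a #>\<^bsub>G\<^esub> b"
      then obtain h where h: "h \<in> solutions M n \<phi> a" "x = h \<otimes>\<^bsub>G\<^esub> b" by (auto simp: r_coset_def)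
      then have hG: "h \<in> carrier G" using sub by blast
      have x: "x \<in> tuples M n" using carr h(2) hG b by auto
      have "h \<in> tuples M n" "holds M \<phi> (h @ a)" using h(1) by (auto simp: solutions_def)
      then have "holds M \<psi> (x @ a @ b @ d)" unfolding *[OF x] using graph_iff[OF _ x] hG h(2) by blast
      then show "x \<in> solutions M n \<psi> (a @ b @ d)" using x by (simp add: solutions_def)
    qed
  qed
  ultimately show ?thesis using d unfolding K_def by blast
qed

lemma subgroup_Inter_in:
  assumes "group G" "\<And>a. a \<in> S \<Longrightarrow> solutions M n \<phi> a \<lhd> G"
  shows "subgroup (Inter_in M n G \<phi> S) G"
proof -
  interpret group G by fact
  have "subgroup (\<Inter>(insert (carrier G) (solutions M n \<phi> ` S))) G"
    by (rule subgroups_Inter) (use assms(2) subgroup_self in \<open>auto intro: normal_imp_subgroup\<close>)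
  then show ?thesis by (simp add: Inter_in_def)
qed

theorem theorem2p4:
  fixes L :: "('f, 'r) language"
    and T :: "('f, 'r) fm set"
    and \<kappa> :: "'k rel"
    and M :: "('f, 'r, 'a) fo_structure"
    and G :: "'a list monoid"
    and \<phi> :: "('f, 'r) fm"
    and n m :: nat
  assumes "complete_theory L T"
    and "monster_model L T \<kappa> M"
    and "NTP2 L M"
    and "definable_group L M n G"
    and "\<phi> \<in> formulas L (n + m)"
  shows "\<exists>k :: nat. \<forall>C. C \<subseteq> tuples M m \<and> (\<forall>a\<in>C. solutions M n \<phi> a \<lhd> G) \<longrightarrow>
           (\<forall>C'. finite C' \<and> C' \<subseteq> C \<longrightarrow>
              (\<exists>C\<^sub>0 \<subseteq> C'. card C\<^sub>0 \<le> k \<and>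
                 finite_index G (Inter_in M n G \<phi> C\<^sub>0) (Inter_in M n G \<phi> C')))"
proof -
  have G: "group G" and carr: "carrier G \<subseteq> tuples M n"
    using assms(4) unfolding definable_group_def definable_def solutions_def by blast+
  interpret group G by (rule G)
  have monster: "saturated L \<kappa> M" "natLeq <o \<kappa>" "univ M \<noteq> {}"
    using assms(2) by (auto simp: monster_model_def is_model_def is_structure_def)
  obtain \<psi> d where d: "set d \<subseteq> univ M" and \<psi>: "\<psi> \<in> formulas L (n + (m + n + length d))"
    and coset: "\<And>a b. a \<in> tuples M m \<Longrightarrow> b \<in> carrier G \<Longrightarrow> solutions M n \<phi> a \<subseteq> carrier G \<Longrightarrow>
       solutions M n \<psi> (a @ b @ d) = solutions M n \<phi> a #>\<^bsub>G\<^esub> b"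
    using coset_formula[OF assms(4,5)] by blast
  define array where "array N A \<longleftrightarrow> (\<forall>i j. A i j \<in> tuples M (m + n + length d)) \<and>
      (\<forall>i<N. \<forall>j j'. j \<noteq> j' \<longrightarrow> solutions M n \<psi> (A i j) \<inter> solutions M n \<psi> (A i j') = {}) \<and>
      (\<forall>f. tuples M n \<inter> (\<Inter>i<N. solutions M n \<psi> (A i (f i))) \<noteq> {})"
    for N :: nat and A :: "nat \<Rightarrow> nat \<Rightarrow> 'a list"
  have "\<not> TP2 M n (m + n + length d) \<psi>" using assms(3) \<psi> unfolding NTP2_def by blast
  moreover have "TP2 M n (m + n + length d) \<psi>" if "\<And>N. \<exists>A. array N A"
    by (rule TP2_if_deep_arrays[OF monster \<psi>]) (rule that[unfolded array_def])
  \<comment> \<open>This \<open>N\<close> is fixed before any \<open>C\<close> is considered, which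
    makes the bound uniform.\<close>
  ultimately obtain N where N: "\<And>A. \<not> array N A" by blast
  have "\<exists>C\<^sub>0 \<subseteq> C'. card C\<^sub>0 \<le> N \<and>
      finite_index G (Inter_in M n G \<phi> C\<^sub>0) (Inter_in M n G \<phi> C')"
    if C': "finite C'" "C' \<subseteq> tuples M m" and normal: "\<And>a. a \<in> C' \<Longrightarrow> solutions M n \<phi> a \<lhd> G" for C'
  proof -
    define X where "X = Inter_in M n G \<phi>"
    define H where "H = solutions M n \<phi>"
    have X: "subgroup (X S) G" if "S \<subseteq> C'" for S
      unfolding X_def by (rule subgroup_Inter_in[OF G]) (use normal that in auto)
    have H: "a \<in> C' \<Longrightarrow> H a \<lhd> G" for a using normal by (simp add: H_def)
    then have HG: "a \<in> C' \<Longrightarrow> H a \<subseteq> carrier G" for a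
      by (meson normal_imp_subgroup subgroup.subset)
    define P where "P S \<longleftrightarrow> S \<subseteq> C' \<and> finite_index G (X S) (X C')" for S
    have "P C'" unfolding P_def using finite_index_refl X by blast
    then obtain C\<^sub>0 where C0: "P C\<^sub>0" and least: "\<And>S. P S \<Longrightarrow> card C\<^sub>0 \<le> card S"
      using ex_has_least_nat[of P C' card] by blast
    have sub: "C\<^sub>0 \<subseteq> C'" and fin: "finite C\<^sub>0" using C0 C'(1) by (auto simp: P_def finite_subset)
    have "card C\<^sub>0 \<le> N"
    proof (rule ccontr)
      assume "\<not> card C\<^sub>0 \<le> N"
      then have gt: "N < card C\<^sub>0" by simp
      have "\<exists>b :: nat \<Rightarrow> 'a list. range b \<subseteq> X (C\<^sub>0 - {a}) \<and> inj (\<lambda>j. H a #>\<^bsub>G\<^esub> b j)" if a: "a \<in> C\<^sub>0" for a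
      proof (rule infinite_index_sequence)
        show "subgroup (X (C\<^sub>0 - {a})) G" by (rule X) (use sub in blast)
        show "H a \<subseteq> carrier G" using HG sub a by blast
        have "X C\<^sub>0 = X (C\<^sub>0 - {a}) \<inter> H a" using a by (auto simp: X_def H_def Inter_in_def)
        \<comment> \<open>Otherwise, by transitivity through \<open>X C\<^sub>0\<close>, the smaller
          set \<open>C\<^sub>0 - {a}\<close> would satisfy \<open>P\<close>, against the choice of
          \<open>C\<^sub>0\<close>.\<close>
        moreover have "\<not> finite_index G (X (C\<^sub>0 - {a})) (X C\<^sub>0)"
        proof
          assume "finite_index G (X (C\<^sub>0 - {a})) (X C\<^sub>0)"
          then have "finite_index G (X (C\<^sub>0 - {a})) (X C')"
            using finite_index_trans[of "X C\<^sub>0" "X C'" "X (C\<^sub>0 - {a})"] C0 sub X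
            unfolding P_def by (auto simp: subgroup.subset X_def Inter_in_def)
          then have "card C\<^sub>0 \<le> card (C\<^sub>0 - {a})" using least sub unfolding P_def by blast
          then show False using a fin by (meson card_Diff1_less not_less)
        qed
        ultimately show "\<not> finite_index G (X (C\<^sub>0 - {a})) (X (C\<^sub>0 - {a}) \<inter> H a)" by simp
      qed
      then obtain b :: "'a list \<Rightarrow> nat \<Rightarrow> 'a list" where
        b: "\<And>a. a \<in> C\<^sub>0 \<Longrightarrow> range (b a) \<subseteq> X (C\<^sub>0 - {a}) \<and> inj (\<lambda>j. H a #>\<^bsub>G\<^esub> b a j)" by metis
      have bG: "b a j \<in> carrier G" if "a \<in> C\<^sub>0" for a j
        using b[OF that] by (auto simp: X_def Inter_in_def)
      have bH: "b a j \<in> H a'" if "a \<in> C\<^sub>0" "a' \<in> C\<^sub>0" "a' \<noteq> a" for a a' j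
        using b[OF that(1)] that by (auto simp: X_def Inter_in_def H_def)
      obtain e where e: "bij_betw e {0..<card C\<^sub>0} C\<^sub>0" using ex_bij_betw_nat_finite fin by blast
      have eC: "i < card C\<^sub>0 \<Longrightarrow> e i \<in> C\<^sub>0" for i using e by (auto simp: bij_betw_def)
      have e_inj: "e i \<noteq> e l" if "i < card C\<^sub>0" "l < card C\<^sub>0" "i \<noteq> l" for i l
        using e that by (auto simp: bij_betw_def inj_on_def)
      \<comment> \<open>Rows from \<open>N\<close> on repeat row 0, so that every entry is a tuple
        of the right length; \<open>e 0\<close> lies in \<open>C\<^sub>0\<close> because
        \<open>N < card C\<^sub>0\<close>.\<close>
      define A where "A i j = (let a = e (if i < N then i else 0) in a @ b a j @ d)" for i j
      have sol: "solutions M n \<psi> (A i j) = H (e i) #>\<^bsub>G\<^esub> b (e i) j" if "i < N" for i j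
      proof -
        have ei: "e i \<in> C\<^sub>0" using eC gt that by simp
        show ?thesis
          using coset[of "e i" "b (e i) j"] ei bG[OF ei] HG[of "e i"] sub C'(2) that
          by (auto simp: A_def H_def Let_def)
      qed
      have "array N A"
        unfolding array_def
      proof (intro conjI allI impI)
        fix i j
        define a where "a = e (if i < N then i else 0)"
        have a: "a \<in> C\<^sub>0" using eC gt by (simp add: a_def)
        then have "a \<in> tuples M m" "b a j \<in> tuples M n" using sub C'(2) bG[OF a] carr by blast+
        then show "A i j \<in> tuples M (m + n + length d)"
          using d by (auto simp: A_def a_def[symmetric] Let_def tuples_def)
      next
        fix i j j' :: nat assume i: "i < N" and j: "j \<noteq> j'"
        have ei: "e i \<in> C\<^sub>0" using eC gt i by simp
        have "H (e i) #>\<^bsub>G\<^esub> b (e i) j \<noteq> H (e i) #>\<^bsub>G\<^esub> b (e i) j'"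
          using b[OF ei] j by (auto simp: inj_def)
        moreover have "subgroup (H (e i)) G" using H ei sub by (auto intro: normal_imp_subgroup)
        ultimately show "solutions M n \<psi> (A i j) \<inter> solutions M n \<psi> (A i j') = {}"
          unfolding sol[OF i] using bG[OF ei] rcos_disjoint[of "H (e i)"]
          by (auto simp: pairwise_def disjnt_def RCOSETS_def)
      next
        fix f :: "nat \<Rightarrow> nat"
        \<comment> \<open>The index set \<open>J\<close> enumerates all of \<open>C\<^sub>0\<close>,
          but a coset is prescribed only for the first \<open>N\<close> subgroups. Injectivity of
          \<open>e\<close> turns distinct indices into distinct members of \<open>C\<^sub>0\<close>,
          as \<open>bH\<close> requires.\<close>
        have "\<exists>x\<in>carrier G. (\<forall>i\<in>{..<N}. H (e i) #>\<^bsub>G\<^esub> x = H (e i) #>\<^bsub>G\<^esub> b (e i) (f i)) \<and>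
            (\<forall>l\<in>{..<card C\<^sub>0} - {..<N}. x \<in> H (e l))"
        proof (rule ex_common_coset_representative)
          show "{..<N} \<subseteq> {..<card C\<^sub>0}" using gt by auto
          show "H (e i) \<lhd> G" if "i \<in> {..<card C\<^sub>0}" for i using that eC sub H by auto
          show "b (e i) (f i) \<in> carrier G" if "i \<in> {..<N}" for i using that gt eC bG by auto
          show "b (e i) (f i) \<in> H (e l)" if "i \<in> {..<N}" "l \<in> {..<card C\<^sub>0}" "l \<noteq> i" for i l
            using that gt eC e_inj[of l i] by (auto intro!: bH)
        qed simp
        then obtain x where x: "x \<in> carrier G"
          "\<And>i. i < N \<Longrightarrow> H (e i) #>\<^bsub>G\<^esub> x = H (e i) #>\<^bsub>G\<^esub> b (e i) (f i)" by auto
        have "x \<in> solutions M n \<psi> (A i (f i))" if i: "i < N" for i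
        proof -
          have "e i \<in> C'" using eC gt i sub by auto
          then have "x \<in> H (e i) #>\<^bsub>G\<^esub> x" using H x(1) by (auto intro: rcos_self normal_imp_subgroup)
          then show ?thesis using sol[OF i] x(2)[OF i] by simp
        qed
        then show "tuples M n \<inter> (\<Inter>i<N. solutions M n \<psi> (A i (f i))) \<noteq> {}" using x(1) carr by blast
      qed
      then show False using N by blast
    qed
    then show ?thesis using C0 unfolding P_def X_def by blast
  qed
  then show ?thesis by (intro exI[of _ N]) blast
qed

end
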